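(* Let $G$ be an $r$-regular graph, and let $I$ be a maximum independent set of $G$. If $G$ admits an $(I,2,r+1)$-defensive silver colouring, then every connected component of $G$ is a copy of the complete graph $K_{r+1}$.
   Context: All graphs are finite, nonempty, simple and undirected. For a vertex $x$, $N(x)$ is the open neighbourhood and $N[x]=N(x)\cup\{x\}$ the closed neighbourhood. $[q]=\{1,\dots,q\}$. A maximum independent set is an independent set of largest possible cardinality. Let $I\subseteq V(G)$ be an independent set and $k\ge 0$. An attack is a set $S\subseteq I$ with $|S|\le k$. A surjective proper colouring $c:V(G)\to[q]$ (adjacent vertices get different colours), with colour classes $C_i=c^{-1}(i)$, is an $(I,k,q)$-defensive silver colouring if for every colour $i\in[q]$ and every attack $S\subseteq I$ there is an injective map $f_{i,S}:S\to C_i$ with $f_{i,S}(x)\in N[x]$ for every $x\in S$. *)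

theory Defs
  imports "Graph_Theory.Graph_Theory"
begin

text \<open>
  A finite simple undirected graph is a digraph satisfying the locale predicate
  \<^const>\<open>graph\<close> (finite, loop-free, no parallel arcs, symmetric): each undirected
  edge is a pair of opposite arcs, and \<open>u \<rightarrow>\<^bsub>G\<^esub> v\<close> is adjacency.  The null graph is
  admitted by \<^const>\<open>graph\<close> and has to be excluded separately.
\<close>

definition open_nbhd :: "('a, 'b) pre_digraph \<Rightarrow> 'a \<Rightarrow> 'a set" where
  "open_nbhd G x = {y. x \<rightarrow>\<^bsub>G\<^esub> y}"

definition closed_nbhd :: "('a, 'b) pre_digraph \<Rightarrow> 'a \<Rightarrow> 'a set" where
  "closed_nbhd G x = insert x (open_nbhd G x)"

text \<open>
  As every edge at \<open>v\<close> contributes exactly one arc leaving \<open>v\<close>, the degree of \<open>v\<close> is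
  its out-degree.
\<close>

definition regular :: "nat \<Rightarrow> ('a, 'b) pre_digraph \<Rightarrow> bool" where
  "regular r G \<longleftrightarrow> (\<forall>v \<in> verts G. out_degree G v = r)"

definition independent_set :: "('a, 'b) pre_digraph \<Rightarrow> 'a set \<Rightarrow> bool" where
  "independent_set G I \<longleftrightarrow> I \<subseteq> verts G \<and> (\<forall>u \<in> I. \<forall>v \<in> I. \<not> u \<rightarrow>\<^bsub>G\<^esub> v)"

definition maximum_independent_set :: "('a, 'b) pre_digraph \<Rightarrow> 'a set \<Rightarrow> bool" where
  "maximum_independent_set G I \<longleftrightarrow>
     independent_set G I \<and> (\<forall>J. independent_set G J \<longrightarrow> card J \<le> card I)"

text \<open>
  Colourings are total functions of which only the values on the vertex set matter.
  Below, \<open>I\<close> is meant to be an independent set of a finite graph, so that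
  \<^const>\<open>card\<close> is only applied to finite sets.
\<close>

definition surj_proper_colouring :: "('a, 'b) pre_digraph \<Rightarrow> nat \<Rightarrow> ('a \<Rightarrow> nat) \<Rightarrow> bool" where
  "surj_proper_colouring G q c \<longleftrightarrow>
     c ` verts G = {1..q} \<and> (\<forall>u v. u \<rightarrow>\<^bsub>G\<^esub> v \<longrightarrow> c u \<noteq> c v)"

definition colour_class :: "('a, 'b) pre_digraph \<Rightarrow> ('a \<Rightarrow> nat) \<Rightarrow> nat \<Rightarrow> 'a set" where
  "colour_class G c i = {v \<in> verts G. c v = i}"

definition defensive_silver_colouring ::
  "('a, 'b) pre_digraph \<Rightarrow> 'a set \<Rightarrow> nat \<Rightarrow> nat \<Rightarrow> ('a \<Rightarrow> nat) \<Rightarrow> bool" where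
  "defensive_silver_colouring G I k q c \<longleftrightarrow>
     surj_proper_colouring G q c \<and>
     (\<forall>i \<in> {1..q}. \<forall>S. S \<subseteq> I \<and> card S \<le> k \<longrightarrow>
        (\<exists>f. inj_on f S \<and> f ` S \<subseteq> colour_class G c i \<and> (\<forall>x \<in> S. f x \<in> closed_nbhd G x)))"

text \<open>
  A subdigraph of a symmetric digraph need not be symmetric, and \<^const>\<open>connected\<close>
  ignores arc directions; but adding arcs preserves connectedness, so a maximal
  connected subdigraph of a graph is induced, hence again a graph.
\<close>

definition connected_component :: "('a, 'b) pre_digraph \<Rightarrow> ('a, 'b) pre_digraph \<Rightarrow> bool" where
  "connected_component G H \<longleftrightarrow> pre_digraph.max_subgraph G connected H"

end

theory Submission
  imports Defs
begin

text \<open>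
  A closed neighbourhood in an \<open>r\<close>-regular graph has exactly \<open>r + 1\<close> vertices, as many as there
  are colours.  Attacks on one vertex \<open>x \<in> I\<close> therefore force every colour to occur exactly once
  in \<open>N[x]\<close>, so the defender has no choice.  In an attack on two vertices \<open>x, y \<in> I\<close> the only
  candidate in colour \<open>c z\<close> for a common vertex \<open>z\<close> of \<open>N[x]\<close> and \<open>N[y]\<close> would be \<open>z\<close> itself for
  both, hence the sets \<open>N[x]\<close> with \<open>x \<in> I\<close> are pairwise disjoint
  (\<open>closed_nbhds_disjoint\<close>).

  From here on the colouring enters only through this disjointness.  By maximality under inclusion,
  the sets \<open>N[x]\<close> cover the graph (\<open>maximum_independent_set_dominates\<close>).  If \<open>N[x]\<close> contained two
  distinct non-adjacent vertices \<open>u\<close> and \<open>v\<close>, then, as no other member of \<open>I\<close> is adjacent to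
  them, replacing \<open>x\<close> by \<open>u\<close> and \<open>v\<close> would give a larger independent set
  (\<open>closed_nbhd_clique\<close>).  So every \<open>N[x]\<close> is a clique on \<open>r + 1\<close> vertices.  Its vertices have
  used up their degree, so no edge leaves it, and it is a component.
\<close>

section \<open>Closed neighbourhoods\<close>

lemma open_nbhd_subset_verts:
  assumes "wf_digraph G"
  shows "open_nbhd G x \<subseteq> verts G"
proof -
  interpret wf_digraph G by fact
  show ?thesis by (auto simp: open_nbhd_def)
qed

lemma closed_nbhd_subset_verts:
  assumes "wf_digraph G" and "x \<in> verts G"
  shows "closed_nbhd G x \<subseteq> verts G"
  using assms open_nbhd_subset_verts[of G x] by (auto simp: closed_nbhd_def)

lemma card_open_nbhd:
  assumes "nomulti_digraph G"
  shows "card (open_nbhd G x) = out_degree G x"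
proof -
  interpret nomulti_digraph G by fact
  have "open_nbhd G x = head G ` out_arcs G x"
    by (auto simp: open_nbhd_def arcs_ends_conv)
  moreover have "inj_on (head G) (out_arcs G x)"
    by (auto intro!: inj_onI no_multi_arcs simp: arc_to_ends_def)
  ultimately show ?thesis
    by (simp add: card_image out_degree_def)
qed

lemma card_closed_nbhd:
  assumes "digraph G"
  shows "card (closed_nbhd G x) = Suc (out_degree G x)"
proof -
  interpret digraph G by fact
  have "finite (open_nbhd G x)"
    using finite_subset[OF open_nbhd_subset_verts[OF wf_digraph] finite_verts] .
  moreover have "x \<notin> open_nbhd G x"
    by (auto simp: open_nbhd_def dest: adj_not_same)
  ultimately show ?thesis
    by (simp add: closed_nbhd_def card_open_nbhd[OF nomulti_digraph])
qed

section \<open>Cliques and components\<close>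

lemma complete_digraph_induce_clique:
  assumes "graph G" and K: "K \<subseteq> verts G"
    and clique: "\<And>u v. u \<in> K \<Longrightarrow> v \<in> K \<Longrightarrow> u \<noteq> v \<Longrightarrow> u \<rightarrow>\<^bsub>G\<^esub> v"
  shows "complete_digraph (card K) (G \<restriction> K)"
proof -
  interpret graph G by fact
  have sub: "induced_subgraph (G \<restriction> K) G"
    using K by (rule induced_induce)
  interpret K: digraph "G \<restriction> K"
    using sub by (intro digraph_subgraph) (rule induced_imp_subgraph)
  have "symmetric (G \<restriction> K)"
    using sym_arcs sub by (rule induced_graph_imp_symmetric)
  then have "graph (G \<restriction> K)"
    by (rule K.graphI)
  moreover have "arcs_ends (G \<restriction> K) = {(u, v). (u, v) \<in> K \<times> K \<and> u \<noteq> v}"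
  proof (intro equalityI subrelI)
    fix u v assume "(u, v) \<in> arcs_ends (G \<restriction> K)"
    then show "(u, v) \<in> {(u, v). (u, v) \<in> K \<times> K \<and> u \<noteq> v}"
      using no_loops by (auto simp: arcs_ends_conv)
  next
    fix u v assume "(u, v) \<in> {(u, v). (u, v) \<in> K \<times> K \<and> u \<noteq> v}"
    then show "(u, v) \<in> arcs_ends (G \<restriction> K)"
      using clique[of u v] by (auto simp: arcs_ends_conv)
  qed
  ultimately show ?thesis
    by (simp add: complete_digraph_def)
qed

lemma connected_complete_digraph:
  assumes "complete_digraph n H" and "verts H \<noteq> {}"
  shows "connected H"
proof -
  interpret graph H
    using assms(1) by (simp add: complete_digraph_def)
  have "u \<rightarrow>\<^sup>*\<^bsub>H\<^esub> v" if "u \<in> verts H" "v \<in> verts H" for u v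
  proof (cases "u = v")
    case False
    then have "u \<rightarrow>\<^bsub>H\<^esub> v"
      using that assms(1) by (simp add: complete_digraph_def)
    then show ?thesis by (rule reachable_adjI)
  qed (use that in auto)
  then show ?thesis
    unfolding connected_def using assms(2)
    by (intro strongly_connectedI) (auto intro: reachable_mk_symmetricI)
qed

lemma connected_verts_subset:
  assumes "connected H" and "k \<in> verts H" and "k \<in> K"
    and closed: "\<And>u v. (u, v) \<in> parcs (mk_symmetric H) \<Longrightarrow> u \<in> K \<Longrightarrow> v \<in> K"
  shows "verts H \<subseteq> K"
proof
  fix v assume "v \<in> verts H"
  then have "k \<rightarrow>\<^sup>*\<^bsub>mk_symmetric H\<^esub> v"
    using assms by (auto simp: connected_def strongly_connected_def)
  then have "(k, v) \<in> rtrancl_on (verts H) (parcs (mk_symmetric H))"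
    by (simp add: reachable_def)
  then show "v \<in> K"
    by (induct rule: rtrancl_on_induct) (use \<open>k \<in> K\<close> closed in auto)
qed

text \<open>
  Without edges leaving \<open>K\<close> a connected subgraph that meets \<open>K\<close> cannot escape from it; since the
  whole clique is connected, a maximal one is all of \<open>G \<restriction> K\<close>.
\<close>
lemma connected_component_eq_closed_clique:
  assumes "graph G" and K: "K \<subseteq> verts G"
    and clique: "\<And>u v. u \<in> K \<Longrightarrow> v \<in> K \<Longrightarrow> u \<noteq> v \<Longrightarrow> u \<rightarrow>\<^bsub>G\<^esub> v"
    and closed: "\<And>u v. u \<in> K \<Longrightarrow> u \<rightarrow>\<^bsub>G\<^esub> v \<Longrightarrow> v \<in> K"
    and comp: "connected_component G H" and meet: "verts H \<inter> K \<noteq> {}"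
  shows "H = G \<restriction> K"
proof (rule ccontr)
  interpret graph G by fact
  assume ne: "H \<noteq> G \<restriction> K"
  have H: "subgraph H G" "connected H"
    and max: "\<And>H'. H' \<noteq> H \<Longrightarrow> subgraph H H' \<Longrightarrow> subgraph H' G \<Longrightarrow> \<not> connected H'"
    using comp by (auto simp: connected_component_def max_subgraph_def)
  have "parcs (mk_symmetric H) \<subseteq> arcs_ends G"
  proof (rule subrelI)
    fix u v assume "(u, v) \<in> parcs (mk_symmetric H)"
    then have "(u, v) \<in> arcs_ends H \<or> (v, u) \<in> arcs_ends H"
      by (auto simp: parcs_mk_symmetric arcs_ends_conv)
    then show "(u, v) \<in> arcs_ends G"
      using arcs_ends_mono[OF H(1)] graph_symmetric by blast
  qed
  then have sub: "verts H \<subseteq> K"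
    using connected_verts_subset[OF H(2)] meet closed by blast
  have "subgraph H (G \<restriction> K)"
  proof -
    have "subgraph H (G \<restriction> verts H)"
      using H(1) by (rule subgraph_induce_subgraphI2)
    moreover have "subgraph (G \<restriction> verts H) (G \<restriction> K)"
      using sub by (auto simp: subgraph_def compatible_def)
    ultimately show ?thesis by (rule subgraph_trans)
  qed
  moreover have "subgraph (G \<restriction> K) G"
    using K by (rule subgraph_induce_subgraphI)
  moreover have "connected (G \<restriction> K)"
    using complete_digraph_induce_clique[OF \<open>graph G\<close> K clique] meet
    by (intro connected_complete_digraph) auto
  ultimately show False
    using max ne by metis
qed

section \<open>Maximum independent sets\<close>

lemma maximum_independent_set_dominates:
  assumes "graph G" and max: "maximum_independent_set G I" and v: "v \<in> verts G"
  obtains x where "x \<in> I" and "v \<in> closed_nbhd G x"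
proof -
  interpret graph G by fact
  have I: "independent_set G I"
    using max by (simp add: maximum_independent_set_def)
  then have fin: "finite I"
    by (auto simp: independent_set_def intro: finite_subset[OF _ finite_verts])
  have "\<exists>x\<in>I. v \<in> closed_nbhd G x"
  proof (rule ccontr)
    assume "\<not> ?thesis"
    then have free: "v \<notin> I" "\<And>x. x \<in> I \<Longrightarrow> \<not> x \<rightarrow>\<^bsub>G\<^esub> v"
      by (auto simp: closed_nbhd_def open_nbhd_def)
    moreover have "\<not> v \<rightarrow>\<^bsub>G\<^esub> x" if "x \<in> I" for x
      using free(2)[OF that] graph_symmetric by blast
    moreover have "\<not> v \<rightarrow>\<^bsub>G\<^esub> v"
      using adj_not_same by blast
    ultimately have "independent_set G (insert v I)"
      using I v by (simp add: independent_set_def)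
    then have "card (insert v I) \<le> card I"
      using max by (simp add: maximum_independent_set_def)
    with free(1) fin show False by simp
  qed
  with that show thesis by blast
qed

text \<open>
  Disjointness says that \<open>x\<close> is the only member of \<open>I\<close> in or adjacent to \<open>N[x]\<close>.  Two
  non-adjacent vertices of \<open>N[x]\<close> could thus both be exchanged for \<open>x\<close>.
\<close>
lemma closed_nbhd_clique:
  assumes "graph G" and max: "maximum_independent_set G I" and x: "x \<in> I"
    and disj: "\<And>y. y \<in> I \<Longrightarrow> y \<noteq> x \<Longrightarrow> closed_nbhd G x \<inter> closed_nbhd G y = {}"
    and u: "u \<in> closed_nbhd G x" and v: "v \<in> closed_nbhd G x" and "u \<noteq> v"
  shows "u \<rightarrow>\<^bsub>G\<^esub> v"
proof (rule ccontr)
  interpret graph G by fact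
  assume nadj: "\<not> u \<rightarrow>\<^bsub>G\<^esub> v"
  have I: "independent_set G I"
    using max by (simp add: maximum_independent_set_def)
  then have fin: "finite I" and xG: "x \<in> verts G"
    using x by (auto simp: independent_set_def intro: finite_subset[OF _ finite_verts])
  have uvG: "u \<in> verts G" "v \<in> verts G"
    using u v closed_nbhd_subset_verts[OF wf_digraph xG] by auto
  have far: "w \<noteq> y" "\<not> y \<rightarrow>\<^bsub>G\<^esub> w" "\<not> w \<rightarrow>\<^bsub>G\<^esub> y"
    if "w \<in> {u, v}" "y \<in> I - {x}" for w y
  proof -
    have "w \<notin> closed_nbhd G y"
      using that disj[of y] u v by auto
    then show "w \<noteq> y" "\<not> y \<rightarrow>\<^bsub>G\<^esub> w" "\<not> w \<rightarrow>\<^bsub>G\<^esub> y"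
      using graph_symmetric by (auto simp: closed_nbhd_def open_nbhd_def)
  qed
  let ?J = "insert u (insert v (I - {x}))"
  have "\<not> v \<rightarrow>\<^bsub>G\<^esub> u"
    using nadj graph_symmetric by blast
  moreover have "\<not> w \<rightarrow>\<^bsub>G\<^esub> w" for w
    using adj_not_same by blast
  ultimately have "\<not> a \<rightarrow>\<^bsub>G\<^esub> b" if "a \<in> ?J" "b \<in> ?J" for a b
    using that far(2)[of b a] far(3)[of a b] I nadj
    unfolding independent_set_def by (elim insertE) simp_all
  then have "independent_set G ?J"
    using I uvG unfolding independent_set_def by blast
  then have "card ?J \<le> card I"
    using max by (simp add: maximum_independent_set_def)
  moreover have "u \<notin> insert v (I - {x})" "v \<notin> I - {x}"
    using far(1) \<open>u \<noteq> v\<close> by blast+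
  then have "card ?J = Suc (Suc (card (I - {x})))"
    using fin by simp
  moreover have "Suc (card (I - {x})) = card I"
    using fin x by (rule card_Suc_Diff1)
  ultimately show False by simp
qed

section \<open>Defence against two simultaneous attacks\<close>

lemma defensive_silver_colouring_defence:
  assumes "defensive_silver_colouring G I k q c" and "i \<in> {1..q}"
    and "S \<subseteq> I" and "card S \<le> k"
  obtains f where "inj_on f S"
    and "\<And>x. x \<in> S \<Longrightarrow> f x \<in> closed_nbhd G x \<and> c (f x) = i"
proof -
  have "\<exists>f. inj_on f S \<and> f ` S \<subseteq> colour_class G c i \<and> (\<forall>x\<in>S. f x \<in> closed_nbhd G x)"
    using assms(1) assms(2-4) by (simp add: defensive_silver_colouring_def)
  then obtain f where "inj_on f S" "f ` S \<subseteq> colour_class G c i"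
    "\<forall>x\<in>S. f x \<in> closed_nbhd G x"
    by auto
  then show thesis
    by (intro that[of f]) (auto simp: colour_class_def)
qed

text \<open>
  Single attacks make \<open>c\<close> map \<open>N[x]\<close> onto the colours; by regularity both sets have \<open>r + 1\<close>
  elements.
\<close>
lemma inj_on_colouring_closed_nbhd:
  assumes "graph G" and "regular r G" and "I \<subseteq> verts G" and x: "x \<in> I"
    and col: "defensive_silver_colouring G I k (r + 1) c" and "k \<ge> 1"
  shows "inj_on c (closed_nbhd G x)"
proof -
  interpret graph G by fact
  have xG: "x \<in> verts G" using x assms(3) by auto
  have sub: "closed_nbhd G x \<subseteq> verts G"
    using wf_digraph xG by (rule closed_nbhd_subset_verts)
  have fin: "finite (closed_nbhd G x)"
    using sub finite_verts by (rule finite_subset)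
  have "i \<in> c ` closed_nbhd G x" if i: "i \<in> {1..r + 1}" for i
  proof -
    obtain f where "f x \<in> closed_nbhd G x \<and> c (f x) = i"
      using defensive_silver_colouring_defence[OF col i, of "{x}"] x \<open>k \<ge> 1\<close> by auto
    then show ?thesis by blast
  qed
  moreover have "c ` closed_nbhd G x \<subseteq> {1..r + 1}"
    using sub col by (auto simp: defensive_silver_colouring_def surj_proper_colouring_def)
  ultimately have "c ` closed_nbhd G x = {1..r + 1}" by blast
  moreover have "card (closed_nbhd G x) = r + 1"
    using card_closed_nbhd[OF digraph_axioms] xG \<open>regular r G\<close> by (simp add: regular_def)
  ultimately show ?thesis
    using fin by (intro eq_card_imp_inj_on) auto
qed

text \<open>
  A common vertex \<open>z\<close> would be the only vertex of its colour in both neighbourhoods, so attacks on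
  \<open>x\<close> and on \<open>y\<close> could both be answered in that colour only by \<open>z\<close>.
\<close>
lemma closed_nbhds_disjoint:
  assumes "graph G" and "regular r G" and "I \<subseteq> verts G"
    and col: "defensive_silver_colouring G I k (r + 1) c" and "k \<ge> 2"
    and x: "x \<in> I" and y: "y \<in> I" and "x \<noteq> y"
  shows "closed_nbhd G x \<inter> closed_nbhd G y = {}"
proof (rule ccontr)
  interpret graph G by fact
  assume "\<not> ?thesis"
  then obtain z where z: "z \<in> closed_nbhd G x" "z \<in> closed_nbhd G y" by auto
  have "x \<in> verts G"
    using x \<open>I \<subseteq> verts G\<close> by auto
  then have "z \<in> verts G"
    using z(1) closed_nbhd_subset_verts[OF wf_digraph, of x] by auto
  then have i: "c z \<in> {1..r + 1}"
    using col by (auto simp: defensive_silver_colouring_def surj_proper_colouring_def)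
  have S: "{x, y} \<subseteq> I" "card {x, y} \<le> k"
    using x y \<open>x \<noteq> y\<close> \<open>k \<ge> 2\<close> by auto
  obtain f where f: "inj_on f {x, y}"
    "\<And>w. w \<in> {x, y} \<Longrightarrow> f w \<in> closed_nbhd G w \<and> c (f w) = c z"
    using defensive_silver_colouring_defence[OF col i S] by metis
  have "f w = z" if "w \<in> {x, y}" for w
  proof -
    have "inj_on c (closed_nbhd G w)"
      using inj_on_colouring_closed_nbhd[OF assms(1-3) _ col, of w] that x y \<open>k \<ge> 2\<close> by auto
    then show ?thesis
      by (rule inj_onD) (use f(2)[OF that] that z in auto)
  qed
  then have "f x = f y" by simp
  with f(1) \<open>x \<noteq> y\<close> show False by auto
qed

section \<open>Components are complete\<close>

theorem theorem2p5:
  fixes G :: "('a, 'b) pre_digraph" and I :: "'a set" and r :: nat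
  assumes "graph G" and "verts G \<noteq> {}"
    and "regular r G"
    and "maximum_independent_set G I"
    and "\<exists>c. defensive_silver_colouring G I 2 (r + 1) c"
  shows "\<forall>H. connected_component G H \<longrightarrow> complete_digraph (r + 1) H"
proof (intro allI impI)
  fix H assume comp: "connected_component G H"
  interpret graph G by fact
  obtain c where col: "defensive_silver_colouring G I 2 (r + 1) c"
    using assms(5) by blast
  have IG: "I \<subseteq> verts G"
    using assms(4) by (auto simp: maximum_independent_set_def independent_set_def)
  have "verts H \<noteq> {}" "verts H \<subseteq> verts G"
    using comp
    by (auto simp: connected_component_def max_subgraph_def connected_def strongly_connected_def
        subgraph_def)
  then obtain h where h: "h \<in> verts H" "h \<in> verts G" by blast
  obtain x where x: "x \<in> I" and hx: "h \<in> closed_nbhd G x"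
    using maximum_independent_set_dominates[OF assms(1,4) h(2)] .
  let ?K = "closed_nbhd G x"
  have K: "?K \<subseteq> verts G"
    using x IG by (intro closed_nbhd_subset_verts wf_digraph) auto
  have clique: "u \<rightarrow>\<^bsub>G\<^esub> v" if "u \<in> ?K" "v \<in> ?K" "u \<noteq> v" for u v
  proof (rule closed_nbhd_clique[OF assms(1,4) x _ that])
    show "closed_nbhd G x \<inter> closed_nbhd G y = {}" if "y \<in> I" "y \<noteq> x" for y
      using closed_nbhds_disjoint[OF assms(1,3) IG col _ x that(1)] that(2) by simp
  qed
  have card: "card (closed_nbhd G u) = r + 1" if "u \<in> verts G" for u
    using card_closed_nbhd[OF digraph_axioms] that assms(3) by (simp add: regular_def)
  have closed: "v \<in> ?K" if "u \<in> ?K" "u \<rightarrow>\<^bsub>G\<^esub> v" for u v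
  proof -
    \<comment> \<open>The other members of the clique already account for all \<open>r\<close> neighbours of \<open>u\<close>.\<close>
    have "?K \<subseteq> closed_nbhd G u"
      using clique[OF that(1)] by (auto simp: closed_nbhd_def[of G u] open_nbhd_def[of G u])
    moreover have "finite (closed_nbhd G u)"
      using K that(1) by (intro finite_subset[OF closed_nbhd_subset_verts finite_verts] wf_digraph) auto
    moreover have "card ?K = card (closed_nbhd G u)"
      using card x IG K that(1) by (metis subsetD)
    ultimately have "?K = closed_nbhd G u"
      by (intro card_subset_eq)
    then show ?thesis
      using that(2) by (simp add: closed_nbhd_def open_nbhd_def)
  qed
  have meet: "verts H \<inter> ?K \<noteq> {}"
    using h(1) hx by auto
  have "H = G \<restriction> ?K"
    using assms(1) K clique closed comp meet
    by (rule connected_component_eq_closed_clique)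
  moreover have "complete_digraph (card ?K) (G \<restriction> ?K)"
    using assms(1) K clique by (rule complete_digraph_induce_clique)
  ultimately show "complete_digraph (r + 1) H"
    using card x IG by auto
qed

end
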